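(* Let $n\ge 0$ be an integer, let $\nu\in\mathbb{C}$, and let $t\in\mathbb{C}$ with $\Re t>0$. Then the $n$-th derivative with respect to the order of the Macdonald function is $$\frac{\partial^{n}}{\partial\nu^{n}}K_{\nu}(t)=\frac{1}{2}\int_{-\infty}^{\infty}x^{n}e^{\nu x-t\cosh x}\,dx .$$
   Context: $I_\nu(t)=\left(\frac t2\right)^{\nu}\sum_{k=0}^{\infty}\frac{(t/2)^{2k}}{k!\,\Gamma(\nu+k+1)}$ is the modified Bessel function of the first kind (principal branch of the power, $1/\Gamma$ taken to be $0$ at the poles of $\Gamma$). The Macdonald function (modified Bessel function of the second kind) is $K_\nu(t)=\frac{\pi}{2}\frac{I_{-\nu}(t)-I_\nu(t)}{\sin\pi\nu}$ for $\nu\notin\mathbb{Z}$, extended to integer $\nu$ by taking the limit in $\nu$. *)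

theory Defs
  imports "HOL-Analysis.Analysis"
begin

text \<open>
  \<^const>\<open>rGamma\<close> is the entire reciprocal Gamma function, equal to 0 at the poles of
  \<^const>\<open>Gamma\<close>; complex \<open>powr\<close> is the principal branch.
\<close>

definition bessel_I :: "complex \<Rightarrow> complex \<Rightarrow> complex" where
  "bessel_I \<nu> t =
     (t / 2) powr \<nu> * (\<Sum>k. (t / 2) ^ (2 * k) / fact k * rGamma (\<nu> + of_nat k + 1))"

definition macdonald_quot :: "complex \<Rightarrow> complex \<Rightarrow> complex" where
  "macdonald_quot \<nu> t =
     of_real pi / 2 * ((bessel_I (-\<nu>) t - bessel_I \<nu> t) / sin (of_real pi * \<nu>))"

text \<open>
  The limit at an integer order is the punctured complex limit in the order; integers being
  isolated, only non-integer orders contribute to it.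
\<close>

definition macdonald_K :: "complex \<Rightarrow> complex \<Rightarrow> complex" where
  "macdonald_K \<nu> t =
     (if \<nu> \<notin> \<int> then macdonald_quot \<nu> t
      else Lim (at \<nu>) (\<lambda>\<mu>. macdonald_quot \<mu> t))"

end

theory Submission
  imports Defs "HOL-Complex_Analysis.Conformal_Mappings"
begin

text \<open>
  Let \<open>J \<nu> t\<close> be the integral for \<open>n = 0\<close>, without the factor \<open>1/2\<close>. Differentiation in \<open>\<nu>\<close> under
  the integral sign reduces everything to \<open>sin (\<pi> \<nu>) J \<nu> t = \<pi> (I (-\<nu>) t - I \<nu> t)\<close>. Both sides are
  entire in \<open>\<nu>\<close>, so it suffices to treat the strip \<open>0 < Re \<nu> < 1\<close>. The pairs \<open>(J \<nu>, J (\<nu> - 1))\<close>,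
  \<open>(I \<nu>, - I (\<nu> - 1))\<close> and \<open>(I (-\<nu>), - I (1 - \<nu>))\<close> solve the same first-order linear system in
  \<open>t\<close>, whose trace is \<open>-1/t\<close>; hence \<open>t\<close> times the Wronskian of any two of them is constant on the
  half-plane. The constants are read off as \<open>t \<rightarrow> 0\<close>, using that \<open>(t/2) powr \<nu> * J \<nu> t\<close> tends to
  \<open>Gamma \<nu>\<close> when \<open>Re \<nu> > 0\<close>, and elimination of \<open>J (1 - \<nu>)\<close> gives the identity on the strip.
\<close>

subsection \<open>Exponential integrals over the real line\<close>

text \<open>The antiderivative \<open>arctan\<close> has finite limits at both ends. This function
  is the majorant in \<open>integrable_cosh_decay\<close>.\<close>

lemma integrable_inverse_one_plus_square: "integrable lborel (\<lambda>x::real. inverse (1 + x\<^sup>2))"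
proof -
  have "set_integrable lborel (einterval (-\<infinity>) \<infinity>) (\<lambda>x::real. inverse (1 + x\<^sup>2))"
  proof (rule interval_integral_FTC_nonneg(1)[where F = arctan and A = "-(pi/2)" and B = "pi/2"])
    show "isCont (\<lambda>x::real. inverse (1 + x\<^sup>2)) x" for x
      by (intro continuous_intros) (metis add_nonneg_eq_0_iff zero_le_one zero_le_power2 zero_neq_one)
    show "((arctan \<circ> real_of_ereal) \<longlongrightarrow> - (pi / 2)) (at_right (-\<infinity>))"
      using tendsto_arctan_at_bot by (simp add: ereal_tendsto_simps)
    show "((arctan \<circ> real_of_ereal) \<longlongrightarrow> pi / 2) (at_left \<infinity>)"
      using tendsto_arctan_at_top by (simp add: ereal_tendsto_simps)
  qed (auto intro!: derivative_eq_intros)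
  then show ?thesis
    by (simp add: einterval_eq set_integrable_def)
qed

text \<open>A single term of the exponential series is at most the whole sum, all terms being
  nonnegative.\<close>

lemma power_le_fact_times_exp: "y ^ k \<le> fact k * exp y" if "y \<ge> 0" for y :: real
proof -
  have "(\<lambda>n. y ^ n /\<^sub>R fact n) sums exp y"
    by (rule exp_converges)
  then have "sum (\<lambda>n. y ^ n /\<^sub>R fact n) {k} \<le> exp y"
    using that by (intro sum_le_suminf[where f = "\<lambda>n. y ^ n /\<^sub>R fact n", THEN order_trans])
      (auto simp: sums_iff)
  then show ?thesis
    by (simp add: scaleR_conv_of_real field_simps)
qed

lemma exp_abs_le_cosh: "exp \<bar>x\<bar> \<le> 2 * cosh x" for x :: real
  by (cases "x \<ge> 0") (auto simp: cosh_field_def)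

lemma cosh_le_exp_abs: "cosh x \<le> exp \<bar>x\<bar>" for x :: real
proof -
  have "exp x \<le> exp \<bar>x\<bar>" "exp (-x) \<le> exp \<bar>x\<bar>"
    unfolding exp_le_cancel_iff by auto
  then have "exp x + exp (-x) \<le> 2 * exp \<bar>x\<bar>"
    by linarith
  then show ?thesis
    unfolding cosh_field_def by (simp only: pos_divide_le_eq zero_less_numeral mult.commute)
qed

text \<open>The growth of \<open>cosh\<close> beats every linear exponent:
  \<open>power_le_fact_times_exp\<close> at \<open>y = exp \<bar>x\<bar> * (b / 2)\<close>, where
  \<open>y \<le> b * cosh x\<close>, bounds any fixed power of \<open>exp \<bar>x\<bar>\<close> by a
  multiple of \<open>exp (b * cosh x)\<close>.\<close>

lemma exp_cosh_decay:
  fixes A b :: real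
  assumes "b > 0"
  obtains C where "\<And>x. exp (A * \<bar>x\<bar> - b * cosh x) \<le> C * exp (-\<bar>x\<bar>)"
proof -
  \<comment> \<open>The 1 added to \<open>A\<close> is what leaves the factor
    \<open>exp (-\<bar>x\<bar>)\<close> in the end.\<close>
  obtain k :: nat where k: "A + 1 \<le> real k"
    using real_arch_simple by blast
  have "exp (A * \<bar>x\<bar> - b * cosh x) \<le> (fact k * (2 / b) ^ k) * exp (-\<bar>x\<bar>)" for x
  proof -
    have "exp ((A + 1) * \<bar>x\<bar>) \<le> exp (real k * \<bar>x\<bar>)"
      using k by (simp add: mult_right_mono)
    also have "\<dots> = (2 / b) ^ k * (exp \<bar>x\<bar> * (b / 2)) ^ k"
      using assms by (simp add: exp_of_nat_mult flip: power_mult_distrib)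
    also have "\<dots> \<le> (2 / b) ^ k * (fact k * exp (exp \<bar>x\<bar> * (b / 2)))"
      using assms by (intro mult_left_mono power_le_fact_times_exp) auto
    also have "\<dots> \<le> (2 / b) ^ k * (fact k * exp (b * cosh x))"
      using assms mult_left_mono[OF exp_abs_le_cosh[of x], of "b / 2"]
      by (intro mult_left_mono) (auto simp: mult_ac)
    finally have "exp ((A + 1) * \<bar>x\<bar>) * exp (- \<bar>x\<bar> - b * cosh x)
        \<le> (2 / b) ^ k * (fact k * exp (b * cosh x)) * exp (- \<bar>x\<bar> - b * cosh x)"
      by (intro mult_right_mono) auto
    moreover have "exp (- \<bar>x\<bar> - b * cosh x) = exp (- \<bar>x\<bar>) / exp (b * cosh x)"
      by (rule exp_diff)
    moreover have "exp ((A + 1) * \<bar>x\<bar>) * exp (- \<bar>x\<bar> - b * cosh x) = exp (A * \<bar>x\<bar> - b * cosh x)"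
      by (simp add: algebra_simps flip: exp_add)
    ultimately show ?thesis
      by (simp add: mult_ac)
  qed
  then show ?thesis using that by blast
qed

text \<open>Integrability test for functions damped by \<open>cosh\<close>: the decay from
  \<open>exp_cosh_decay\<close> is compared with \<open>inverse (1 + x\<^sup>2)\<close>.\<close>

lemma integrable_cosh_decay:
  fixes f :: "real \<Rightarrow> 'a::{banach, second_countable_topology}"
  assumes [measurable]: "f \<in> borel_measurable borel" and "b > 0"
    and le: "\<And>x. norm (f x) \<le> M * exp (A * \<bar>x\<bar> - b * cosh x)"
  shows "integrable lborel f"
proof -
  obtain C where C: "\<And>x. exp (A * \<bar>x\<bar> - b * cosh x) \<le> C * exp (-\<bar>x\<bar>)"
    using exp_cosh_decay[OF \<open>b > 0\<close>] by blast
  \<comment> \<open>The signs of \<open>M\<close> and \<open>C\<close> are read off from the bounds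
    at 0.\<close>
  have M: "M \<ge> 0"
    using order_trans[OF norm_ge_zero le[of 0]] by (simp add: zero_le_mult_iff)
  have "C \<ge> 0"
    using order_trans[OF less_imp_le[OF exp_gt_zero] C[of 0]] by simp
  show ?thesis
  proof (rule Bochner_Integration.integrable_bound)
    show "integrable lborel (\<lambda>x::real. M * C * 2 * inverse (1 + x\<^sup>2))"
      using integrable_inverse_one_plus_square by (intro integrable_mult_right) auto
    show "AE x in lborel. norm (f x) \<le> norm (M * C * 2 * inverse (1 + x\<^sup>2))"
    proof (rule AE_I2)
      fix x :: real
      have "1 + x\<^sup>2 \<le> 2 * exp \<bar>x\<bar>"
        using exp_lower_Taylor_quadratic[of "\<bar>x\<bar>"] by simp
      moreover have "1 + x\<^sup>2 > 0"
        by (simp add: add_pos_nonneg)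
      ultimately have "exp (-\<bar>x\<bar>) \<le> 2 * inverse (1 + x\<^sup>2)"
        by (simp add: exp_minus field_simps)
      then have "M * (C * exp (-\<bar>x\<bar>)) \<le> M * (C * (2 * inverse (1 + x\<^sup>2)))"
        using M \<open>C \<ge> 0\<close> by (intro mult_left_mono) auto
      moreover have "norm (f x) \<le> M * (C * exp (-\<bar>x\<bar>))"
        using order_trans[OF le mult_left_mono[OF C M]] .
      ultimately show "norm (f x) \<le> norm (M * C * 2 * inverse (1 + x\<^sup>2))"
        by (simp add: mult_ac)
    qed
  qed simp
qed

text \<open>First-order Taylor remainder. It is quadratic in \<open>norm u\<close> and grows
  exponentially only with the real part.\<close>

lemma norm_exp_minus_linear_le: "norm (exp u - 1 - u) \<le> (norm u)\<^sup>2 * exp \<bar>Re u\<bar>" for u :: complex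
  using Taylor_exp[of u 1] by (simp add: algebra_simps power2_eq_square)

text \<open>For increments \<open>h\<close> with \<open>norm h \<le> r\<close>, the integrand of the
  linearization error is at most \<open>(norm h)\<^sup>2\<close> times the integrand of
  \<open>int2\<close>, so the error itself is quadratic in \<open>h\<close>. The order is treated
  with \<open>w\<close> the identity, the argument with \<open>w = cosh\<close>.\<close>

lemma has_field_derivative_integral_exp:
  fixes g :: "real \<Rightarrow> complex" and w :: "real \<Rightarrow> real"
  assumes [measurable]: "g \<in> borel_measurable borel" "w \<in> borel_measurable borel" and "r > 0"
    and int0: "integrable lborel (\<lambda>x. g x * exp (z * of_real (w x)))"
    and int1: "integrable lborel (\<lambda>x. g x * of_real (w x) * exp (z * of_real (w x)))"
    and int2: "integrable lborel (\<lambda>x. norm (g x) * (w x)\<^sup>2 * exp (Re z * w x + r * \<bar>w x\<bar>))"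
  shows "((\<lambda>z. LINT x|lborel. g x * exp (z * of_real (w x))) has_field_derivative
           (LINT x|lborel. g x * of_real (w x) * exp (z * of_real (w x)))) (at z)"
proof -
  define F where "F z = (LINT x|lborel. g x * exp (z * of_real (w x)))" for z
  define D where "D = (LINT x|lborel. g x * of_real (w x) * exp (z * of_real (w x)))"
  define M where "M = (LINT x|lborel. norm (g x) * (w x)\<^sup>2 * exp (Re z * w x + r * \<bar>w x\<bar>))"
  have bound: "norm (F (z + h) - F z - D * h) \<le> M * (norm h)\<^sup>2" if h: "norm h \<le> r" for h
  proof -
    define R where "R x = g x * exp ((z + h) * of_real (w x)) - g x * exp (z * of_real (w x))
        - g x * of_real (w x) * exp (z * of_real (w x)) * h" for x
    have R_eq: "R x = g x * exp (z * of_real (w x)) * (exp (h * of_real (w x)) - 1 - h * of_real (w x))" for x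
      by (simp add: R_def algebra_simps exp_add)
    have R_le: "norm (R x) \<le> norm (norm (g x) * (w x)\<^sup>2 * exp (Re z * w x + r * \<bar>w x\<bar>) * (norm h)\<^sup>2)" for x
    proof -
      have "\<bar>Re h * w x\<bar> \<le> r * \<bar>w x\<bar>"
        using abs_Re_le_cmod[of h] h by (simp add: abs_mult mult_right_mono)
      then have "norm (exp (h * of_real (w x)) - 1 - h * of_real (w x))
          \<le> (norm h)\<^sup>2 * (w x)\<^sup>2 * exp (r * \<bar>w x\<bar>)"
        using norm_exp_minus_linear_le[of "h * of_real (w x)"]
        by (elim order_trans) (auto simp: norm_mult power_mult_distrib intro!: mult_left_mono)
      then have "norm (R x) \<le> norm (g x) * exp (Re z * w x) * ((norm h)\<^sup>2 * (w x)\<^sup>2 * exp (r * \<bar>w x\<bar>))"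
        unfolding R_eq norm_mult norm_exp_eq_Re by (intro mult_mono) auto
      then show ?thesis
        by (simp add: exp_add mult_ac abs_mult)
    qed
    have intR: "integrable lborel R"
    proof (rule Bochner_Integration.integrable_bound)
      show "integrable lborel (\<lambda>x. norm (g x) * (w x)\<^sup>2 * exp (Re z * w x + r * \<bar>w x\<bar>) * (norm h)\<^sup>2)"
        by (intro integrable_mult_left int2)
      show "R \<in> borel_measurable lborel"
        unfolding R_def by measurable
      show "AE x in lborel. norm (R x) \<le> norm (norm (g x) * (w x)\<^sup>2 * exp (Re z * w x + r * \<bar>w x\<bar>) * (norm h)\<^sup>2)"
        using R_le by simp
    qed
    \<comment> \<open>Adding the known integrable terms back to \<open>R\<close> shows that the
      integrand at \<open>z + h\<close> is integrable as well.\<close>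
    have "integrable lborel (\<lambda>x. R x + (g x * exp (z * of_real (w x)) +
        g x * of_real (w x) * exp (z * of_real (w x)) * h))"
      by (intro Bochner_Integration.integrable_add intR int0 integrable_mult_left int1)
    then have "integrable lborel (\<lambda>x. g x * exp ((z + h) * of_real (w x)))"
      by (simp add: R_def)
    then have "F (z + h) - F z - D * h = (LINT x|lborel. R x)"
      unfolding F_def D_def R_def using int0 int1 by simp
    also have "norm \<dots> \<le> (LINT x|lborel. norm (R x))"
      by (rule integral_norm_bound)
    also have "\<dots> \<le> (LINT x|lborel. norm (g x) * (w x)\<^sup>2 * exp (Re z * w x + r * \<bar>w x\<bar>) * (norm h)\<^sup>2)"
      using R_le by (intro integral_mono integrable_norm intR integrable_mult_left int2) (simp add: abs_mult)
    also have "\<dots> = M * (norm h)\<^sup>2"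
      unfolding M_def by simp
    finally show ?thesis .
  qed
  have "((\<lambda>h. (F (z + h) - F z) / h - D) \<longlongrightarrow> 0) (at 0)"
  proof (rule Lim_null_comparison)
    \<comment> \<open>Division by \<open>h\<close> turns the quadratic bound into
      \<open>M * norm h\<close>.\<close>
    show "((\<lambda>h::complex. M * norm h) \<longlongrightarrow> 0) (at 0)"
      by (auto intro!: tendsto_eq_intros)
    have "\<forall>\<^sub>F h in at (0::complex). norm h < r \<and> h \<noteq> 0"
      using \<open>r > 0\<close> by (auto simp: eventually_at dist_norm)
    then show "\<forall>\<^sub>F h in at 0. norm ((F (z + h) - F z) / h - D) \<le> M * norm h"
    proof eventually_elim
      case (elim h)
      then have "(F (z + h) - F z) / h - D = (F (z + h) - F z - D * h) / h"
        by (simp add: field_simps)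
      then show ?case
        using bound[of h] elim by (simp add: norm_divide power2_eq_square divide_le_eq mult_ac)
    qed
  qed
  then show ?thesis
    unfolding DERIV_def F_def[symmetric] D_def[symmetric] using LIM_zero_iff by blast
qed

subsection \<open>The integral representation\<close>

lemma cosh_of_real: "cosh (of_real x) = (of_real (cosh x) :: complex)"
  by (simp add: cosh_def exp_of_real scaleR_conv_of_real flip: of_real_minus)

lemma sinh_of_real: "sinh (of_real x) = (of_real (sinh x) :: complex)"
  by (simp add: sinh_def exp_of_real scaleR_conv_of_real flip: of_real_minus)

lemma borel_measurable_cosh [measurable]: "(cosh :: real \<Rightarrow> real) \<in> borel_measurable borel"
  by (intro borel_measurable_continuous_onI continuous_intros)

text \<open>Each derivative in the order raises \<open>n\<close> by one; each derivative in the
  argument raises \<open>m\<close> by one and changes the sign.\<close>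

definition macdonald_integrand :: "nat \<Rightarrow> nat \<Rightarrow> complex \<Rightarrow> complex \<Rightarrow> real \<Rightarrow> complex" where
  "macdonald_integrand n m \<nu> t x =
     of_real x ^ n * of_real (cosh x) ^ m * exp (\<nu> * of_real x - t * of_real (cosh x))"

lemma macdonald_integrand_measurable [measurable]:
  "macdonald_integrand n m \<nu> t \<in> borel_measurable borel"
  unfolding macdonald_integrand_def[abs_def] by measurable

lemma macdonald_integrand_shift_order:
  "macdonald_integrand n m (\<nu> + 1) t x = exp (of_real x) * macdonald_integrand n m \<nu> t x"
  "macdonald_integrand n m (\<nu> - 1) t x = exp (- of_real x) * macdonald_integrand n m \<nu> t x"
  by (simp_all add: macdonald_integrand_def algebra_simps flip: exp_add)

lemma exp_of_real_add_exp_minus: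
  "exp (of_real x) + exp (- of_real x) = (2 * of_real (cosh x) :: complex)"
  "exp (of_real x) - exp (- of_real x) = (2 * of_real (sinh x) :: complex)"
  unfolding cosh_of_real[symmetric] sinh_of_real[symmetric]
  by (simp_all add: cosh_def sinh_def scaleR_conv_of_real)

text \<open>All factors are turned into exponentials, giving the shape that
  \<open>integrable_cosh_decay\<close> expects: the power of \<open>x\<close> costs
  \<open>fact n\<close> and one unit in the exponent, the power of \<open>cosh x\<close> costs
  \<open>m\<close> units.\<close>

lemma norm_macdonald_integrand_le:
  "norm (macdonald_integrand n m \<nu> t x)
     \<le> fact n * exp ((1 + real m + \<bar>Re \<nu>\<bar>) * \<bar>x\<bar> - Re t * cosh x)"
proof -
  have "\<bar>x\<bar> ^ n \<le> fact n * exp \<bar>x\<bar>"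
    by (rule power_le_fact_times_exp) simp
  moreover have "cosh x ^ m \<le> exp (real m * \<bar>x\<bar>)"
    unfolding exp_of_nat_mult by (intro power_mono cosh_le_exp_abs) simp
  moreover have "Re \<nu> * x \<le> \<bar>Re \<nu>\<bar> * \<bar>x\<bar>"
    by (metis abs_ge_self abs_mult)
  ultimately have "\<bar>x\<bar> ^ n * cosh x ^ m * exp (Re \<nu> * x - Re t * cosh x)
      \<le> (fact n * exp \<bar>x\<bar>) * exp (real m * \<bar>x\<bar>) * exp (\<bar>Re \<nu>\<bar> * \<bar>x\<bar> - Re t * cosh x)"
    by (intro mult_mono) auto
  also have "\<dots> = fact n * exp ((1 + real m + \<bar>Re \<nu>\<bar>) * \<bar>x\<bar> - Re t * cosh x)"
    by (simp add: exp_diff distrib_right exp_add)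
  finally show ?thesis
    by (simp add: macdonald_integrand_def norm_mult norm_power)
qed

lemma integrable_macdonald_integrand:
  "Re t > 0 \<Longrightarrow> integrable lborel (macdonald_integrand n m \<nu> t)"
  by (rule integrable_cosh_decay[OF macdonald_integrand_measurable _ norm_macdonald_integrand_le])

definition macdonald_integral :: "nat \<Rightarrow> complex \<Rightarrow> complex \<Rightarrow> complex" where
  "macdonald_integral n \<nu> t = (LINT x|lborel. macdonald_integrand n 0 \<nu> t x)"

lemma macdonald_integral_deriv_order:
  assumes "Re t > 0"
  shows "((\<lambda>\<nu>. macdonald_integral n \<nu> t) has_field_derivative macdonald_integral (Suc n) \<nu> t) (at \<nu>)"
proof -
  define g where "g x = of_real x ^ n * exp (- t * of_real (cosh x))" for x :: real
  have g: "g x * exp (\<nu> * of_real x) = macdonald_integrand n 0 \<nu> t x"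
    "g x * of_real x * exp (\<nu> * of_real x) = macdonald_integrand (Suc n) 0 \<nu> t x" for x \<nu>
    by (simp_all add: g_def macdonald_integrand_def exp_diff exp_minus divide_inverse mult_ac)
  have "((\<lambda>\<nu>. LINT x|lborel. g x * exp (\<nu> * of_real x)) has_field_derivative
           (LINT x|lborel. g x * of_real x * exp (\<nu> * of_real x))) (at \<nu>)"
  proof (rule has_field_derivative_integral_exp[where r = 1])
    show "g \<in> borel_measurable borel"
      unfolding g_def[abs_def] by measurable
    show "integrable lborel (\<lambda>x. norm (g x) * x\<^sup>2 * exp (Re \<nu> * x + 1 * \<bar>x\<bar>))"
    proof (rule integrable_cosh_decay[OF _ \<open>Re t > 0\<close>])
      show "(\<lambda>x. norm (g x) * x\<^sup>2 * exp (Re \<nu> * x + 1 * \<bar>x\<bar>)) \<in> borel_measurable borel"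
        unfolding g_def[abs_def] by measurable
      fix x :: real
      \<comment> \<open>The second derivative in the order is the integrand with
        \<open>n + 2\<close>; the radius 1 adds only a factor \<open>exp \<bar>x\<bar>\<close>,
        which the decay absorbs.\<close>
      have g2: "g x * of_real x ^ 2 * exp (\<nu> * of_real x) = macdonald_integrand (n + 2) 0 \<nu> t x"
        by (simp add: g_def macdonald_integrand_def exp_diff exp_minus divide_inverse power_add power2_eq_square mult_ac)
      have "norm (norm (g x) * x\<^sup>2 * exp (Re \<nu> * x + 1 * \<bar>x\<bar>))
          = norm (macdonald_integrand (n + 2) 0 \<nu> t x) * exp \<bar>x\<bar>"
        unfolding g2[symmetric] by (simp add: norm_mult norm_power exp_add)
      also have "\<dots> \<le> fact (n + 2) * exp ((1 + real 0 + \<bar>Re \<nu>\<bar>) * \<bar>x\<bar> - Re t * cosh x) * exp \<bar>x\<bar>"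
        by (intro mult_right_mono norm_macdonald_integrand_le) simp
      also have "\<dots> = fact (n + 2) * exp ((2 + \<bar>Re \<nu>\<bar>) * \<bar>x\<bar> - Re t * cosh x)"
        unfolding mult.assoc exp_add[symmetric] by (simp add: algebra_simps)
      finally show "norm (norm (g x) * x\<^sup>2 * exp (Re \<nu> * x + 1 * \<bar>x\<bar>))
          \<le> fact (n + 2) * exp ((2 + \<bar>Re \<nu>\<bar>) * \<bar>x\<bar> - Re t * cosh x)" .
    qed
  qed (auto simp: g integrable_macdonald_integrand assms)
  then show ?thesis
    by (simp add: g macdonald_integral_def)
qed

lemma macdonald_integral_plus_one_add_minus_one:
  assumes "Re t > 0"
  shows "macdonald_integral 0 (\<nu> + 1) t + macdonald_integral 0 (\<nu> - 1) t
    = 2 * (LINT x|lborel. macdonald_integrand 0 1 \<nu> t x)"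
proof -
  have "macdonald_integrand 0 0 (\<nu> + 1) t x + macdonald_integrand 0 0 (\<nu> - 1) t x
      = 2 * macdonald_integrand 0 1 \<nu> t x" for x
    unfolding macdonald_integrand_shift_order distrib_right[symmetric] exp_of_real_add_exp_minus
    by (simp add: macdonald_integrand_def)
  then have "(LINT x|lborel. macdonald_integrand 0 0 (\<nu> + 1) t x + macdonald_integrand 0 0 (\<nu> - 1) t x)
      = (LINT x|lborel. 2 * macdonald_integrand 0 1 \<nu> t x)"
    by presburger
  then show ?thesis
    unfolding macdonald_integral_def
    by (simp add: integrable_macdonald_integrand assms)
qed

text \<open>Differentiation brings down \<open>- cosh x\<close>, and \<open>2 * cosh x\<close> is
  the sum of the two factors that shift the order by 1 and by -1.\<close>

lemma macdonald_integral_deriv_arg: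
  assumes "Re t > 0"
  shows "((\<lambda>t. macdonald_integral 0 \<nu> t) has_field_derivative
     - (macdonald_integral 0 (\<nu> + 1) t + macdonald_integral 0 (\<nu> - 1) t) / 2) (at t)"
proof -
  define g where "g x = exp (\<nu> * of_real x)" for x :: real
  have g_meas: "g \<in> borel_measurable borel"
    unfolding g_def[abs_def] by measurable
  have g: "g x * exp (- t * of_real (cosh x)) = macdonald_integrand 0 0 \<nu> t x"
    "g x * of_real (cosh x) * exp (- t * of_real (cosh x)) = macdonald_integrand 0 1 \<nu> t x" for x t
    by (simp_all add: g_def macdonald_integrand_def exp_diff exp_minus divide_inverse mult_ac)
  have "((\<lambda>z. LINT x|lborel. g x * exp (z * of_real (cosh x))) has_field_derivative
           (LINT x|lborel. g x * of_real (cosh x) * exp (- t * of_real (cosh x)))) (at (- t))"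
  \<comment> \<open>The radius \<open>Re t / 2\<close> uses up half of the decay, so the majorant is
    the norm of an integrand with argument \<open>t / 2\<close>.\<close>
  proof (rule has_field_derivative_integral_exp[where g = g and w = cosh and z = "- t" and r = "Re t / 2"])
    have "norm (g x) * (cosh x)\<^sup>2 * exp (Re (- t) * cosh x + Re t / 2 * \<bar>cosh x\<bar>)
        = norm (macdonald_integrand 0 2 \<nu> (t / 2) x)" for x
    proof -
      have "g x * of_real (cosh x) ^ 2 * exp (- (t / 2) * of_real (cosh x)) = macdonald_integrand 0 2 \<nu> (t / 2) x"
        unfolding g_def macdonald_integrand_def power_0 mult_1
        by (simp only: mult.left_commute mult.assoc diff_conv_add_uminus exp_add mult_minus_left)
      then have "norm (macdonald_integrand 0 2 \<nu> (t / 2) x)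
          = norm (g x * of_real (cosh x) ^ 2 * exp (- (t / 2) * of_real (cosh x)))"
        by (rule arg_cong[OF sym])
      also have "\<dots> = norm (g x) * (cosh x)\<^sup>2 * exp (Re (- t) * cosh x + Re t / 2 * \<bar>cosh x\<bar>)"
        unfolding norm_mult norm_power norm_of_real norm_exp_eq_Re abs_of_nonneg[OF cosh_real_nonneg]
        by (simp add: algebra_simps)
      finally show ?thesis ..
    qed
    then show "integrable lborel (\<lambda>x. norm (g x) * (cosh x)\<^sup>2 * exp (Re (- t) * cosh x + Re t / 2 * \<bar>cosh x\<bar>))"
      using assms by (simp add: integrable_macdonald_integrand)
  next
    show "integrable lborel (\<lambda>x. g x * exp (- t * of_real (cosh x)))"
      "integrable lborel (\<lambda>x. g x * of_real (cosh x) * exp (- t * of_real (cosh x)))"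
      unfolding g by (intro integrable_macdonald_integrand assms)+
  qed (use assms g_meas in simp_all)
  then have "((\<lambda>t. LINT x|lborel. g x * exp ((- t) * of_real (cosh x))) has_field_derivative
           (LINT x|lborel. g x * of_real (cosh x) * exp (- t * of_real (cosh x))) * (- 1)) (at t)"
    by (rule DERIV_chain2) (auto intro!: derivative_eq_intros)
  then have "((\<lambda>t. macdonald_integral 0 \<nu> t) has_field_derivative
           (LINT x|lborel. macdonald_integrand 0 1 \<nu> t x) * (- 1)) (at t)"
    unfolding g macdonald_integral_def .
  moreover have "(LINT x|lborel. macdonald_integrand 0 1 \<nu> t x) * (- 1)
      = - (macdonald_integral 0 (\<nu> + 1) t + macdonald_integral 0 (\<nu> - 1) t) / 2"
    unfolding macdonald_integral_plus_one_add_minus_one[OF assms, of \<nu>] by simp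
  ultimately show ?thesis
    by (simp only:)
qed

text \<open>The function \<open>exp (\<nu> * x - t * cosh x)\<close> vanishes at both ends of the
  line, so its derivative, with factor \<open>\<nu> - t * sinh x\<close>, has integral 0. The
  \<open>sinh\<close> splits into the two shifted orders.\<close>

lemma macdonald_integral_recurrence:
  assumes "Re t > 0"
  shows "2 * \<nu> * macdonald_integral 0 \<nu> t
    = t * (macdonald_integral 0 (\<nu> + 1) t - macdonald_integral 0 (\<nu> - 1) t)"
proof -
  define F where "F = macdonald_integrand 0 0 \<nu> t"
  define f where "f x = \<nu> * F x - t / 2 * (macdonald_integrand 0 0 (\<nu> + 1) t x
      - macdonald_integrand 0 0 (\<nu> - 1) t x)" for x
  have deriv: "(F has_vector_derivative f x) (at x)" for x
  proof -
    have "((\<lambda>z. exp (\<nu> * z - t * cosh z)) has_field_derivative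
        (\<nu> - t * sinh (of_real x)) * exp (\<nu> * of_real x - t * cosh (of_real x))) (at (of_real x))"
      by (auto intro!: derivative_eq_intros)
    then have "((\<lambda>x. exp (\<nu> * of_real x - t * of_real (cosh x))) has_vector_derivative
        (\<nu> - t * of_real (sinh x)) * exp (\<nu> * of_real x - t * of_real (cosh x))) (at x)"
      unfolding cosh_of_real[symmetric] sinh_of_real[symmetric] by (rule has_vector_derivative_real_field)
    moreover have "(\<nu> - t * of_real (sinh x)) * exp (\<nu> * of_real x - t * of_real (cosh x)) = f x"
      unfolding f_def F_def macdonald_integrand_shift_order left_diff_distrib[symmetric] exp_of_real_add_exp_minus
      by (simp add: macdonald_integrand_def algebra_simps)
    ultimately show ?thesis
      by (simp add: F_def macdonald_integrand_def[abs_def])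
  qed
  obtain C where C: "\<And>x. exp ((1 + real 0 + \<bar>Re \<nu>\<bar>) * \<bar>x\<bar> - Re t * cosh x) \<le> C * exp (-\<bar>x\<bar>)"
    using exp_cosh_decay[OF assms] by blast
  have F_le: "norm (F x) \<le> C * exp (-\<bar>x\<bar>)" for x
    using norm_macdonald_integrand_le[of 0 0 \<nu> t x] C[of x] unfolding F_def fact_0 mult_1 by (rule order_trans)
  have lim: "((\<lambda>x::real. C * exp (-\<bar>x\<bar>)) \<longlongrightarrow> 0) at_top" "((\<lambda>x::real. C * exp (-\<bar>x\<bar>)) \<longlongrightarrow> 0) at_bot"
  proof -
    have "((\<lambda>x::real. C * exp (-x)) \<longlongrightarrow> 0) at_top"
      by (intro tendsto_mult_right_zero filterlim_compose[OF exp_at_bot filterlim_uminus_at_bot_at_top])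
    then show "((\<lambda>x::real. C * exp (-\<bar>x\<bar>)) \<longlongrightarrow> 0) at_top"
      by (rule Lim_transform_eventually)
        (auto intro: eventually_mono[OF eventually_ge_at_top[of 0]])
    have "((\<lambda>x::real. C * exp x) \<longlongrightarrow> 0) at_bot"
      by (intro tendsto_mult_right_zero exp_at_bot)
    then show "((\<lambda>x::real. C * exp (-\<bar>x\<bar>)) \<longlongrightarrow> 0) at_bot"
      by (rule Lim_transform_eventually)
        (auto intro: eventually_mono[OF eventually_le_at_bot[of 0]])
  qed
  have "(F \<longlongrightarrow> 0) at_top" "(F \<longlongrightarrow> 0) at_bot"
    using Lim_null_comparison[OF always_eventually lim(1)]
      Lim_null_comparison[OF always_eventually lim(2)] F_le by blast+
  moreover have f_int: "integrable lborel f"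
    unfolding f_def F_def
    by (intro Bochner_Integration.integrable_diff integrable_mult_right integrable_macdonald_integrand assms)
  ultimately have "(LBINT x=-\<infinity>..\<infinity>. f x) = 0 - 0"
  proof (intro interval_integral_FTC_integrable)
    show "isCont f x" for x
      unfolding f_def F_def macdonald_integrand_def by (intro continuous_intros)
  qed (auto simp: deriv ereal_tendsto_simps einterval_eq set_integrable_def)
  then have "(LINT x|lborel. f x) = 0"
    by (simp add: interval_lebesgue_integral_def einterval_eq set_lebesgue_integral_def)
  moreover have "(LINT x|lborel. f x) = \<nu> * macdonald_integral 0 \<nu> t
      - t / 2 * (macdonald_integral 0 (\<nu> + 1) t - macdonald_integral 0 (\<nu> - 1) t)"
    unfolding f_def F_def macdonald_integral_def
    by (simp add: integrable_macdonald_integrand assms)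
  ultimately show ?thesis
    by (simp add: algebra_simps)
qed

text \<open>Reflection of the integration variable, \<open>cosh\<close> being even.\<close>

lemma macdonald_integral_minus: "macdonald_integral 0 (- \<nu>) t = macdonald_integral 0 \<nu> t"
  unfolding macdonald_integral_def
  by (subst lborel_integral_real_affine[where c = "-1" and t = 0])
     (simp_all add: macdonald_integrand_def[abs_def])

subsection \<open>The modified Bessel function of the first kind\<close>

text \<open>Finitely many shifts stay in a compact disc. Beyond them the functional equation
  \<open>z * rGamma (z + 1) = rGamma z\<close> with \<open>norm z \<ge> 1\<close> makes the norms
  nonincreasing in \<open>k\<close>. Uniformity in the order is what the Weierstrass test needs
  later.\<close>

lemma rGamma_shift_bounded:
  obtains M where "\<And>(\<nu>::complex) k. norm \<nu> \<le> R \<Longrightarrow> norm (rGamma (\<nu> + of_nat k + 1)) \<le> M"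
proof -
  obtain N :: nat where N: "R \<le> real N"
    using real_arch_simple by blast
  have "bounded (rGamma ` cball (0::complex) (R + real N + 1))"
    by (intro compact_imp_bounded compact_continuous_image continuous_intros) auto
  then obtain M where M: "\<And>z::complex. norm z \<le> R + real N + 1 \<Longrightarrow> norm (rGamma z) \<le> M"
    unfolding bounded_iff by (metis imageI mem_cball_0)
  have "norm (rGamma (\<nu> + of_nat k + 1)) \<le> M" if \<nu>: "norm \<nu> \<le> R" for \<nu> :: complex and k
  proof (induction k)
    case 0
    show ?case
      using norm_triangle_ineq[of \<nu> 1] \<nu> by (intro M) auto
  next
    case (Suc k)
    show ?case
    proof (cases "Suc k \<le> N")
      case True
      have "norm (\<nu> + of_nat (Suc k) + 1) \<le> norm \<nu> + norm (of_nat (Suc k) :: complex) + norm (1::complex)"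
        by norm
      then show ?thesis
        using True \<nu> by (intro M) (simp del: of_nat_Suc)
    next
      case False
      \<comment> \<open>Since \<open>Suc k\<close> exceeds \<open>N\<close> and \<open>N\<close> is
        at least \<open>R\<close>, the factor in the functional equation has norm at least
        1.\<close>
      have "norm (of_nat (Suc k) :: complex) \<le> norm (\<nu> + of_nat (Suc k)) + norm \<nu>"
        by norm
      moreover have "real N + 1 \<le> real (Suc k)"
        using False by linarith
      ultimately have "1 \<le> norm (\<nu> + of_nat k + 1)"
        using N \<nu> unfolding norm_of_nat by (simp add: add_ac)
      then have "norm (rGamma (\<nu> + of_nat (Suc k) + 1))
          \<le> norm (\<nu> + of_nat k + 1) * norm (rGamma (\<nu> + of_nat (Suc k) + 1))"
        using mult_right_mono by fastforce
      also have "\<dots> = norm (rGamma (\<nu> + of_nat k + 1))"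
        using rGamma_plus1[of "\<nu> + of_nat k + 1"] by (simp add: add_ac flip: norm_mult)
      finally show ?thesis
        using Suc.IH by linarith
    qed
  qed
  then show ?thesis using that by blast
qed

text \<open>The regularized hypergeometric function 0F1 with parameter \<open>\<nu> + 1\<close>: the
  factor of \<open>bessel_I\<close> that is entire in \<open>w = (t / 2)\<^sup>2\<close> and free of
  branch cuts.\<close>

definition bessel_series :: "complex \<Rightarrow> complex \<Rightarrow> complex" where
  "bessel_series \<nu> w = (\<Sum>k. w ^ k / fact k * rGamma (\<nu> + of_nat k + 1))"

lemma bessel_I_eq: "bessel_I \<nu> t = (t / 2) powr \<nu> * bessel_series \<nu> ((t / 2)\<^sup>2)"
  by (simp add: bessel_I_def bessel_series_def power_mult)

lemma norm_bessel_term_le: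
  assumes "norm (rGamma (\<nu> + of_nat k + 1) :: complex) \<le> M"
  shows "norm (w ^ k / fact k * rGamma (\<nu> + of_nat k + 1)) \<le> M * (norm w ^ k / fact k)"
  using mult_right_mono[OF assms, of "norm w ^ k / fact k"]
  by (simp add: norm_mult norm_divide norm_power mult_ac)

lemma summable_power_div_fact: "summable (\<lambda>k. M * (x ^ k / fact k))" for x :: real
  using summable_exp[of x] by (intro summable_mult) (simp add: field_simps)

lemma summable_bessel_series: "summable (\<lambda>k. w ^ k / fact k * rGamma (\<nu> + of_nat k + 1 :: complex))"
proof -
  obtain M where "\<And>(\<mu>::complex) k. norm \<mu> \<le> norm \<nu> \<Longrightarrow> norm (rGamma (\<mu> + of_nat k + 1)) \<le> M"
    using rGamma_shift_bounded by blast
  then show ?thesis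
    by (intro summable_comparison_test'[OF summable_power_div_fact[of M "norm w"]] norm_bessel_term_le) auto
qed

lemma bessel_series_sums:
  "(\<lambda>k. w ^ k / fact k * rGamma (\<nu> + of_nat k + 1)) sums bessel_series \<nu> w"
  unfolding bessel_series_def by (intro summable_sums summable_bessel_series)

lemma bessel_series_0 [simp]: "bessel_series \<nu> 0 = rGamma (\<nu> + 1)"
  unfolding bessel_series_def by (subst suminf_finite[of "{0}"]) auto

text \<open>The factor \<open>k + 1\<close> from termwise differentiation cancels against the
  factorial, and the index shift raises the order.\<close>

lemma bessel_series_deriv: "(bessel_series \<nu> has_field_derivative bessel_series (\<nu> + 1) w) (at w)"
proof -
  define c where "c k = rGamma (\<nu> + of_nat k + 1) / fact k" for k
  have "bessel_series \<nu> = (\<lambda>w. \<Sum>k. c k * w ^ k)"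
    by (simp add: bessel_series_def c_def fun_eq_iff mult_ac)
  moreover have "bessel_series (\<nu> + 1) w = (\<Sum>k. diffs c k * w ^ k)"
    unfolding bessel_series_def diffs_def c_def
    by (intro suminf_cong) (simp add: divide_simps add_ac del: of_nat_Suc, simp add: algebra_simps)
  moreover have "summable (\<lambda>k. c k * w ^ k)" for w
    using summable_bessel_series[of w \<nu>] by (simp add: c_def mult_ac)
  ultimately show ?thesis
    using termdiffs_strong_converges_everywhere[of c w] by simp
qed

text \<open>Each coefficient on the left is
  \<open>rGamma (\<nu> + k) = (\<nu> + k) * rGamma (\<nu> + k + 1)\<close>. The \<open>\<nu>\<close>
  part gives the first summand; the \<open>k\<close> part has no term at \<open>k = 0\<close> and
  gives the second after an index shift.\<close>

lemma bessel_series_recurrence: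
  "bessel_series (\<nu> - 1) w = \<nu> * bessel_series \<nu> w + w * bessel_series (\<nu> + 1) w"
proof -
  define f where "f k = of_nat k * (w ^ k / fact k * rGamma (\<nu> + of_nat k + 1))" for k
  have "f (Suc k) = w * (w ^ k / fact k * rGamma (\<nu> + 1 + of_nat k + 1))" for k
  proof -
    have "of_nat (Suc k) / fact (Suc k) = (1 / fact k :: complex)"
      by (simp add: divide_simps del: of_nat_Suc)
    moreover have "\<nu> + of_nat (Suc k) + 1 = \<nu> + 1 + of_nat k + 1"
      by simp
    ultimately show ?thesis
      unfolding f_def by (metis (no_types, lifting) mult.assoc mult.commute power_Suc times_divide_eq_left times_divide_eq_right mult_1)
  qed
  then have "(\<lambda>k. f (Suc k)) sums (w * bessel_series (\<nu> + 1) w)"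
    by (simp only: sums_mult[OF bessel_series_sums])
  then have "f sums (w * bessel_series (\<nu> + 1) w + f 0)"
    by (rule sums_Suc)
  moreover have "f 0 = 0"
    by (simp add: f_def)
  ultimately have "f sums (w * bessel_series (\<nu> + 1) w)"
    by (simp only: add_0_right)
  then have "(\<lambda>k. \<nu> * (w ^ k / fact k * rGamma (\<nu> + of_nat k + 1)) + f k)
      sums (\<nu> * bessel_series \<nu> w + w * bessel_series (\<nu> + 1) w)"
    by (intro sums_add sums_mult bessel_series_sums)
  moreover have "\<nu> * (w ^ k / fact k * rGamma (\<nu> + of_nat k + 1)) + f k
      = w ^ k / fact k * rGamma (\<nu> - 1 + of_nat k + 1)" for k
  proof -
    have "\<nu> * (w ^ k / fact k * rGamma (\<nu> + of_nat k + 1)) + f k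
        = w ^ k / fact k * ((\<nu> + of_nat k) * rGamma (\<nu> + of_nat k + 1))"
      by (simp add: f_def algebra_simps)
    moreover have "\<nu> - 1 + of_nat k + 1 = \<nu> + of_nat k"
      by simp
    ultimately show ?thesis
      by (simp only: rGamma_plus1)
  qed
  ultimately have "(\<lambda>k. w ^ k / fact k * rGamma (\<nu> - 1 + of_nat k + 1))
      sums (\<nu> * bessel_series \<nu> w + w * bessel_series (\<nu> + 1) w)"
    by (simp only:)
  then show ?thesis
    by (rule sums_unique2[OF bessel_series_sums])
qed

text \<open>The partial sums are holomorphic because \<open>rGamma\<close> is entire, and they
  converge uniformly on closed unit discs by the Weierstrass test.\<close>

lemma bessel_series_holomorphic_order: "(\<lambda>\<nu>. bessel_series \<nu> w) holomorphic_on UNIV"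
proof (rule holomorphic_uniform_sequence)
  show "(\<lambda>\<nu>. \<Sum>k<n. w ^ k / fact k * rGamma (\<nu> + of_nat k + 1)) holomorphic_on UNIV" for n
    by (intro holomorphic_intros)
  fix \<nu> :: complex
  obtain M where M: "\<And>(\<mu>::complex) k. norm \<mu> \<le> norm \<nu> + 1 \<Longrightarrow> norm (rGamma (\<mu> + of_nat k + 1)) \<le> M"
    using rGamma_shift_bounded by blast
  have "uniform_limit (cball \<nu> 1) (\<lambda>n \<nu>. \<Sum>k<n. w ^ k / fact k * rGamma (\<nu> + of_nat k + 1))
      (\<lambda>\<nu>. bessel_series \<nu> w) sequentially"
    unfolding bessel_series_def
  proof (rule Weierstrass_m_test[OF _ summable_power_div_fact[of M "norm w"]])
    fix k \<mu> assume "\<mu> \<in> cball \<nu> 1"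
    then have "norm \<mu> \<le> norm \<nu> + 1"
      using norm_triangle_ineq2[of \<mu> \<nu>] by (simp add: dist_norm norm_minus_commute)
    then show "norm (w ^ k / fact k * rGamma (\<mu> + of_nat k + 1)) \<le> M * (norm w ^ k / fact k)"
      by (intro norm_bessel_term_le M)
  qed
  then show "\<exists>d>0. cball \<nu> d \<subseteq> UNIV \<and> uniform_limit (cball \<nu> d)
      (\<lambda>n \<nu>. \<Sum>k<n. w ^ k / fact k * rGamma (\<nu> + of_nat k + 1)) (\<lambda>\<nu>. bessel_series \<nu> w) sequentially"
    by (intro exI[of _ 1]) auto
qed auto

lemma bessel_I_holomorphic_order:
  assumes "t \<noteq> 0" shows "(\<lambda>\<nu>. bessel_I \<nu> t) holomorphic_on UNIV"
  unfolding bessel_I_eq using assms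
  by (intro holomorphic_intros bessel_series_holomorphic_order)

lemma bessel_I_recurrence:
  assumes "t \<noteq> 0"
  shows "bessel_I (\<nu> - 1) t - bessel_I (\<nu> + 1) t = 2 * \<nu> / t * bessel_I \<nu> t"
proof -
  have "bessel_I (\<nu> - 1) t - bessel_I (\<nu> + 1) t
      = (t / 2) powr \<nu> * (bessel_series (\<nu> - 1) ((t / 2)\<^sup>2) / (t / 2)
          - t / 2 * bessel_series (\<nu> + 1) ((t / 2)\<^sup>2))"
    using assms by (simp add: bessel_I_eq powr_diff powr_add algebra_simps)
  also have "\<dots> = 2 * \<nu> / t * bessel_I \<nu> t"
    using assms unfolding bessel_series_recurrence bessel_I_eq
    by (simp add: field_simps power2_eq_square)
  finally show ?thesis .
qed

lemma bessel_I_deriv: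
  assumes "Re t > 0"
  shows "(bessel_I \<nu> has_field_derivative bessel_I (\<nu> + 1) t + \<nu> / t * bessel_I \<nu> t) (at t)"
proof -
  \<comment> \<open>The half-plane keeps \<open>t / 2\<close> away from the branch cut of the
    power.\<close>
  have t: "t \<noteq> 0" "t / 2 \<notin> \<real>\<^sub>\<le>\<^sub>0"
    using assms by (auto simp: complex_nonpos_Reals_iff)
  have "((\<lambda>t. (t / 2) powr \<nu> * bessel_series \<nu> ((t / 2)\<^sup>2)) has_field_derivative
      (\<nu> * (t / 2) powr (\<nu> - 1) * (1 / 2)) * bessel_series \<nu> ((t / 2)\<^sup>2)
      + (bessel_series (\<nu> + 1) ((t / 2)\<^sup>2) * (t / 2)) * (t / 2) powr \<nu>) (at t)"
  proof (intro DERIV_mult)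
    show "((\<lambda>t. (t / 2) powr \<nu>) has_field_derivative \<nu> * (t / 2) powr (\<nu> - 1) * (1 / 2)) (at t)"
      by (rule DERIV_chain2[where f = "\<lambda>z. z powr \<nu>" and g = "\<lambda>t. t / 2", OF has_field_derivative_powr[OF t(2), where s = \<nu>]])
        (auto intro!: derivative_eq_intros)
    show "((\<lambda>t. bessel_series \<nu> ((t / 2)\<^sup>2)) has_field_derivative
        bessel_series (\<nu> + 1) ((t / 2)\<^sup>2) * (t / 2)) (at t)"
      by (rule DERIV_chain2[where g = "\<lambda>t. (t / 2)\<^sup>2", OF bessel_series_deriv])
        (auto intro!: derivative_eq_intros)
  qed
  also have "(\<nu> * (t / 2) powr (\<nu> - 1) * (1 / 2)) * bessel_series \<nu> ((t / 2)\<^sup>2)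
      + (bessel_series (\<nu> + 1) ((t / 2)\<^sup>2) * (t / 2)) * (t / 2) powr \<nu>
      = bessel_I (\<nu> + 1) t + \<nu> / t * bessel_I \<nu> t"
    using t by (simp add: bessel_I_eq powr_diff powr_add field_simps)
  finally show ?thesis
    by (simp add: bessel_I_eq[abs_def])
qed

text \<open>Companion of \<open>bessel_I_deriv\<close> with the order lowered; both forms together
  close the first-order system for two neighbouring orders.\<close>

lemma bessel_I_deriv_minus_one:
  assumes "Re t > 0"
  shows "(bessel_I \<nu> has_field_derivative bessel_I (\<nu> - 1) t - \<nu> / t * bessel_I \<nu> t) (at t)"
proof -
  have "bessel_I (\<nu> + 1) t + \<nu> / t * bessel_I \<nu> t = bessel_I (\<nu> - 1) t - \<nu> / t * bessel_I \<nu> t"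
  proof -
    have "t \<noteq> 0"
      using assms by auto
    from bessel_I_recurrence[OF this, of \<nu>] show ?thesis
      by (simp add: algebra_simps)
  qed
  then show ?thesis
    using bessel_I_deriv[OF assms, of \<nu>] by (simp only:)
qed

subsection \<open>Behaviour at small argument\<close>

lemma of_real_exp_powr: "of_real (exp a) powr \<nu> = exp (\<nu> * of_real a)" for a :: real and \<nu> :: complex
  by (simp add: powr_def Ln_of_real)

text \<open>Euler's integral for Gamma after the substitution \<open>u = exp y\<close>.\<close>

lemma Gamma_integral_exp:
  assumes "Re \<nu> > 0"
  shows "integrable lborel (\<lambda>y::real. exp (\<nu> * of_real y - of_real (exp y)))"
    and "(LINT y|lborel. exp (\<nu> * of_real y - of_real (exp y))) = Gamma \<nu>"
proof -
  define f where "f y = exp (\<nu> * of_real y - of_real (exp y))" for y :: real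
  define h where "h u = of_real u powr (\<nu> - 1) / of_real (exp u)" for u :: real
  have fh: "inverse u *\<^sub>R f (ln u) = h u" if "u > 0" for u
  proof -
    have "of_real u powr (\<nu> - 1) = exp ((\<nu> - 1) * of_real (ln u))"
      using of_real_exp_powr[of "ln u"] that by simp
    moreover have "of_real (inverse u) = (exp (- of_real (ln u)) :: complex)"
      using that by (simp add: exp_minus exp_of_real)
    ultimately show ?thesis
      using that by (simp add: f_def h_def scaleR_conv_of_real algebra_simps exp_of_real
          flip: exp_of_real exp_add exp_diff)
  qed
  have h_int: "set_integrable lborel {0<..} h"
  proof -
    \<comment> \<open>Integrability passes from \<open>lebesgue\<close> to \<open>lborel\<close>
      because \<open>h\<close> is continuous, hence Borel, on the half-line.\<close>
    have "set_integrable lebesgue {0<..} h"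
      using absolutely_integrable_Gamma_integral'[OF assms] unfolding h_def .
    moreover have "continuous_on {0<..} h"
      unfolding h_def by (intro continuous_intros) auto
    then have "(\<lambda>u. indicator {0<..} u *\<^sub>R h u) \<in> borel_measurable lborel"
      by (simp add: borel_measurable_continuous_on_indicator)
    ultimately show ?thesis
      unfolding set_integrable_def by (simp add: integrable_completion)
  qed
  have ln_lim: "((ereal \<circ> ln \<circ> real_of_ereal) \<longlongrightarrow> -\<infinity>) (at_right (ereal 0))"
      "((ereal \<circ> ln \<circ> real_of_ereal) \<longlongrightarrow> \<infinity>) (at_left \<infinity>)"
    using ln_at_0 ln_at_top by (simp_all add: ereal_tendsto_simps)
  have einterval: "einterval (ereal 0) \<infinity> = {0<..}"
    by (auto simp: einterval_def)
  \<comment> \<open>The nonnegative function \<open>norm (f y)\<close> is substituted first. This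
    yields the integrability of \<open>f\<close> that the substitution for the complex integral
    below presupposes.\<close>
  have "set_integrable lborel (einterval (-\<infinity>) \<infinity>) (\<lambda>y. norm (f y))"
  proof (rule interval_integral_substitution_nonneg(1)[where g = ln and g' = inverse])
    show "set_integrable lborel (einterval (ereal 0) \<infinity>) (\<lambda>u. norm (f (ln u)) * inverse u)"
    proof -
      have "set_integrable lborel {0<..} (\<lambda>u. norm (h u))"
        by (rule set_integrable_norm[OF h_int])
      moreover have "norm (h u) = norm (f (ln u)) * inverse u" if "u > 0" for u
        unfolding fh[OF that, symmetric] using that by simp
      ultimately show ?thesis
        unfolding einterval by (subst set_integrable_cong[OF refl, where f' = "\<lambda>u. norm (h u)"]) auto
    qed
    show "isCont (\<lambda>y. norm (f y)) (ln u)" for u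
      unfolding f_def by (intro continuous_intros)
  qed (use ln_lim in \<open>auto intro!: derivative_eq_intros continuous_intros simp: field_simps\<close>)
  then have "integrable lborel (\<lambda>y. norm (f y))"
    by (simp add: set_integrable_def einterval_eq)
  moreover have "f \<in> borel_measurable lborel"
    unfolding f_def[abs_def] by measurable
  ultimately have f_int: "integrable lborel f"
    using integrable_norm_iff by blast
  then show "integrable lborel (\<lambda>y::real. exp (\<nu> * of_real y - of_real (exp y)))"
    unfolding f_def .
  have "(LBINT y=-\<infinity>..\<infinity>. f y) = (LBINT u=ereal 0..\<infinity>. inverse u *\<^sub>R f (ln u))"
  proof (rule interval_integral_substitution_integrable[where g = ln and g' = inverse])
    show "set_integrable lborel (einterval (ereal 0) \<infinity>) (\<lambda>u. inverse u *\<^sub>R f (ln u))"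
      unfolding einterval using h_int fh by (subst set_integrable_cong[OF refl, where f' = h]) auto
    show "set_integrable lborel (einterval (-\<infinity>) \<infinity>) f"
      using f_int by (simp add: set_integrable_def einterval_eq)
    show "isCont f (ln u)" for u
      unfolding f_def by (intro continuous_intros)
  qed (use ln_lim in \<open>auto intro!: derivative_eq_intros continuous_intros simp: field_simps\<close>)
  also have "\<dots> = (LBINT u:{0<..}. h u)"
    unfolding interval_lebesgue_integral_def einterval
    by (simp, intro set_lebesgue_integral_cong) (auto simp: fh)
  also have "\<dots> = integral {0<..} h"
    by (rule set_borel_integral_eq_integral(2)[OF h_int])
  also have "\<dots> = Gamma \<nu>"
    using Gamma_integral_complex'[OF assms] unfolding h_def by (rule integral_unique)
  finally show "(LINT y|lborel. exp (\<nu> * of_real y - of_real (exp y))) = Gamma \<nu>"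
    by (simp add: f_def interval_lebesgue_integral_def einterval_eq set_lebesgue_integral_def)
qed

lemma exp_minus_of_nat_tendsto_0: "(\<lambda>n. exp (- real n)) \<longlonglongrightarrow> 0"
  by (intro filterlim_compose[OF exp_at_bot] filterlim_compose[OF filterlim_uminus_at_bot_at_top]
      filterlim_real_sequentially)

text \<open>Translation of the variable by \<open>a\<close>: then
  \<open>2 * exp a * cosh (y - a) = exp y + exp (2 * a - y)\<close>, and the power in front cancels
  the shift in the exponent \<open>\<nu> * x\<close>.\<close>

lemma macdonald_integral_two_exp:
  "of_real (exp a) powr \<nu> * macdonald_integral 0 \<nu> (2 * of_real (exp a))
    = (LINT y|lborel. exp (\<nu> * of_real y - of_real (exp y) - of_real (exp (2 * a - y))))"
proof -
  have "macdonald_integral 0 \<nu> (2 * of_real (exp a))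
      = (LINT y|lborel. macdonald_integrand 0 0 \<nu> (2 * of_real (exp a)) (- a + 1 * y))"
    unfolding macdonald_integral_def by (subst lborel_integral_real_affine[where c = 1 and t = "- a"]) simp_all
  also have "of_real (exp a) powr \<nu> * \<dots>
      = (LINT y|lborel. exp (\<nu> * of_real a) * macdonald_integrand 0 0 \<nu> (2 * of_real (exp a)) (- a + 1 * y))"
    by (simp add: of_real_exp_powr)
  also have "\<dots> = (LINT y|lborel. exp (\<nu> * of_real y - of_real (exp y) - of_real (exp (2 * a - y))))"
  proof (intro Bochner_Integration.integral_cong refl)
    fix y :: real
    have "2 * exp a * cosh (- a + y) = exp y + exp (2 * a - y)"
    proof -
      have "exp a * exp (y - a) = exp y" "exp a * exp (a - y) = exp (2 * a - y)"
        by (simp_all flip: exp_add)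
      then show ?thesis
        by (simp add: cosh_field_def algebra_simps)
    qed
    then have "of_real (2 * exp a * cosh (- a + y)) = (of_real (exp y + exp (2 * a - y)) :: complex)"
      by (rule arg_cong)
    then have "2 * of_real (exp a) * of_real (cosh (- a + y)) = (of_real (exp y) + of_real (exp (2 * a - y)) :: complex)"
      by (simp only: of_real_mult of_real_add of_real_numeral)
    then show "exp (\<nu> * of_real a) * macdonald_integrand 0 0 \<nu> (2 * of_real (exp a)) (- a + 1 * y)
        = exp (\<nu> * of_real y - of_real (exp y) - of_real (exp (2 * a - y)))"
      by (simp add: macdonald_integrand_def algebra_simps flip: exp_add)
  qed
  finally show ?thesis .
qed

text \<open>Dominated convergence with \<open>a = - n\<close>: the term
  \<open>exp (2 * a - y)\<close> tends to 0 and only decreases the norm, so the Gamma integrand is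
  the majorant.\<close>

lemma macdonald_integral_small_arg:
  assumes "Re \<nu> > 0"
  shows "(\<lambda>n. of_real (exp (- real n)) powr \<nu> * macdonald_integral 0 \<nu> (2 * of_real (exp (- real n))))
    \<longlonglongrightarrow> Gamma \<nu>"
  unfolding macdonald_integral_two_exp Gamma_integral_exp(2)[OF assms, symmetric]
proof (rule integral_dominated_convergence)
  show "integrable lborel (\<lambda>y::real. norm (exp (\<nu> * of_real y - of_real (exp y))))"
    by (intro integrable_norm Gamma_integral_exp(1) assms)
  show "AE y in lborel. (\<lambda>n. exp (\<nu> * of_real y - of_real (exp y) - of_real (exp (2 * - real n - y))))
      \<longlonglongrightarrow> exp (\<nu> * of_real y - of_real (exp y))"
  proof (rule AE_I2)
    fix y :: real
    have "(\<lambda>n. (exp (- real n))\<^sup>2 * exp (- y)) \<longlonglongrightarrow> 0\<^sup>2 * exp (- y)"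
      by (intro tendsto_intros exp_minus_of_nat_tendsto_0)
    moreover have "(exp (- real n))\<^sup>2 * exp (- y) = exp (2 * - real n - y)" for n
      by (simp add: power2_eq_square flip: exp_add)
    ultimately have "(\<lambda>n. exp (2 * - real n - y)) \<longlonglongrightarrow> 0"
      by simp
    then have "(\<lambda>n. exp (\<nu> * of_real y - of_real (exp y) - of_real (exp (2 * - real n - y))))
        \<longlonglongrightarrow> exp (\<nu> * of_real y - of_real (exp y) - of_real 0)"
      by (intro tendsto_intros)
    then show "(\<lambda>n. exp (\<nu> * of_real y - of_real (exp y) - of_real (exp (2 * - real n - y))))
        \<longlonglongrightarrow> exp (\<nu> * of_real y - of_real (exp y))"
      by simp
  qed
qed (auto intro!: borel_measurable_continuous_onI continuous_intros)

lemma bessel_series_small_arg: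
  "(\<lambda>n. bessel_series \<nu> ((of_real (exp (- real n)))\<^sup>2)) \<longlonglongrightarrow> rGamma (\<nu> + 1)"
proof -
  have "isCont (bessel_series \<nu>) 0"
    using bessel_series_deriv DERIV_isCont by blast
  moreover have "(\<lambda>n. (of_real (exp (- real n)))\<^sup>2 :: complex) \<longlonglongrightarrow> (of_real 0)\<^sup>2"
    by (intro tendsto_intros exp_minus_of_nat_tendsto_0)
  ultimately show ?thesis
    using isCont_tendsto_compose[of 0 "bessel_series \<nu>"] by simp
qed

text \<open>The half-plane is convex, so \<open>f\<close> is constant there, and a single sequence
  tending to 0 identifies the constant.\<close>

lemma eq_limit_along_exp:
  fixes f :: "complex \<Rightarrow> complex"
  assumes deriv: "\<And>t. Re t > 0 \<Longrightarrow> (f has_field_derivative 0) (at t)"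
    and lim: "(\<lambda>n. f (2 * of_real (exp (- real n)))) \<longlonglongrightarrow> L" and "Re t > 0"
  shows "f t = L"
proof -
  have "convex {t. Re t > 0}"
    by (rule convex_halfspace_Re_gt)
  then obtain c where c: "\<And>t. Re t > 0 \<Longrightarrow> f t = c"
    using has_field_derivative_zero_constant[of "{t. Re t > 0}" f]
      has_field_derivative_at_within[OF deriv] by (metis mem_Collect_eq)
  then have "(\<lambda>n. f (2 * of_real (exp (- real n)))) = (\<lambda>n. c)"
    by (intro ext c) simp
  then show ?thesis
    using lim c \<open>Re t > 0\<close> by (metis LIMSEQ_const_iff)
qed

subsection \<open>Wronskians\<close>

text \<open>As the argument tends to 0, the first product contributes
  \<open>2 * Gamma \<nu> * rGamma \<nu> = 2\<close>, and the second vanishes. Both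
  \<open>\<nu>\<close> and \<open>1 - \<nu>\<close> have positive real part, as the Gamma
  asymptotics require.\<close>

lemma wronskian_macdonald_bessel:
  assumes "0 < Re \<nu>" "Re \<nu> < 1" "Re t > 0"
  shows "t * (macdonald_integral 0 \<nu> t * bessel_I (\<nu> - 1) t
    + macdonald_integral 0 (1 - \<nu>) t * bessel_I \<nu> t) = 2"
proof (rule eq_limit_along_exp[OF _ _ \<open>Re t > 0\<close>,
    where f = "\<lambda>t. t * (macdonald_integral 0 \<nu> t * bessel_I (\<nu> - 1) t
        + macdonald_integral 0 (1 - \<nu>) t * bessel_I \<nu> t)"])
  fix t :: complex assume t: "Re t > 0"
  then have t0: "t \<noteq> 0"
    by auto
  define P Q R S where "P = macdonald_integral 0 \<nu> t" and "Q = macdonald_integral 0 (1 - \<nu>) t"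
    and "R = bessel_I \<nu> t" and "S = bessel_I (\<nu> - 1) t"
  \<comment> \<open>Evenness in the order closes the system on the pair \<open>P\<close>,
    \<open>Q\<close>.\<close>
  have Q: "macdonald_integral 0 (\<nu> - 1) t = Q"
    using macdonald_integral_minus[of "1 - \<nu>" t] by (simp add: Q_def)
  have "- (macdonald_integral 0 (\<nu> + 1) t + macdonald_integral 0 (\<nu> - 1) t) / 2 = - Q - \<nu> / t * P"
    using macdonald_integral_recurrence[OF t, of \<nu>] t0 unfolding Q P_def
    by (simp add: field_simps)
  then have dP: "(macdonald_integral 0 \<nu> has_field_derivative (- Q - \<nu> / t * P)) (at t)"
    using macdonald_integral_deriv_arg[OF t, of \<nu>] by (simp only:)
  have P: "macdonald_integral 0 (1 - \<nu> - 1) t = P"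
    using macdonald_integral_minus[of \<nu> t] by (simp add: P_def)
  have "- (macdonald_integral 0 (1 - \<nu> + 1) t + macdonald_integral 0 (1 - \<nu> - 1) t) / 2
      = - P - (1 - \<nu>) / t * Q"
    using macdonald_integral_recurrence[OF t, of "1 - \<nu>"] t0 unfolding P Q_def
    by (simp add: field_simps)
  then have dQ: "(macdonald_integral 0 (1 - \<nu>) has_field_derivative (- P - (1 - \<nu>) / t * Q)) (at t)"
    using macdonald_integral_deriv_arg[OF t, of "1 - \<nu>"] by (simp only:)
  have dR: "(bessel_I \<nu> has_field_derivative (S - \<nu> / t * R)) (at t)"
    using bessel_I_deriv_minus_one[OF t, of \<nu>] by (simp add: R_def S_def)
  have dS: "(bessel_I (\<nu> - 1) has_field_derivative (R + (\<nu> - 1) / t * S)) (at t)"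
    using bessel_I_deriv[OF t, of "\<nu> - 1"] by (simp add: R_def S_def)
  have "((\<lambda>t. t * (macdonald_integral 0 \<nu> t * bessel_I (\<nu> - 1) t
        + macdonald_integral 0 (1 - \<nu>) t * bessel_I \<nu> t)) has_field_derivative
      1 * (P * S + Q * R) + ((- Q - \<nu> / t * P) * S + (R + (\<nu> - 1) / t * S) * P
        + ((- P - (1 - \<nu>) / t * Q) * R + (S - \<nu> / t * R) * Q)) * t) (at t)"
    unfolding P_def Q_def R_def S_def
    by (intro DERIV_mult DERIV_add DERIV_ident dP[unfolded P_def Q_def] dQ[unfolded P_def Q_def]
        dR[unfolded R_def S_def] dS[unfolded R_def S_def])
  \<comment> \<open>The mixed terms cancel, and the remaining coefficients \<open>-1/t\<close>
    cancel the derivative of the factor \<open>t\<close>.\<close>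
  also have "1 * (P * S + Q * R) + ((- Q - \<nu> / t * P) * S + (R + (\<nu> - 1) / t * S) * P
        + ((- P - (1 - \<nu>) / t * Q) * R + (S - \<nu> / t * R) * Q)) * t = 0"
    using t0 by (simp add: field_simps)
  finally show "((\<lambda>t. t * (macdonald_integral 0 \<nu> t * bessel_I (\<nu> - 1) t
        + macdonald_integral 0 (1 - \<nu>) t * bessel_I \<nu> t)) has_field_derivative 0) (at t)" .
next
  define s where "s n = (of_real (exp (- real n)) :: complex)" for n
  have s0: "s n \<noteq> 0" for n
    by (simp add: s_def)
  \<comment> \<open>The powers of \<open>s n\<close> are distributed so that every factor has a
    limit; the surplus is \<open>s n powr (2 * \<nu>)\<close>, which tends to 0.\<close>
  have eq: "2 * s n * (macdonald_integral 0 \<nu> (2 * s n) * bessel_I (\<nu> - 1) (2 * s n)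
        + macdonald_integral 0 (1 - \<nu>) (2 * s n) * bessel_I \<nu> (2 * s n))
      = 2 * ((s n powr \<nu> * macdonald_integral 0 \<nu> (2 * s n)) * bessel_series (\<nu> - 1) ((s n)\<^sup>2))
      + 2 * ((s n powr (1 - \<nu>) * macdonald_integral 0 (1 - \<nu>) (2 * s n))
          * bessel_series \<nu> ((s n)\<^sup>2) * s n powr (2 * \<nu>))" for n
  proof -
    have "s n powr (2 * \<nu>) = s n powr \<nu> * s n powr \<nu>"
      using powr_add[of "s n" \<nu> \<nu>] by simp
    then show ?thesis
      using s0[of n] by (simp add: bessel_I_eq powr_diff field_simps)
  qed
  have "(\<lambda>n. s n powr (2 * \<nu>)) \<longlonglongrightarrow> 0"
  proof (rule Lim_null_comparison)
    have "(\<lambda>n. exp (- real n) powr (2 * Re \<nu>)) \<longlonglongrightarrow> 0 powr (2 * Re \<nu>)"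
      using assms(1) by (intro tendsto_powr' exp_minus_of_nat_tendsto_0 tendsto_const) auto
    then show "(\<lambda>n. exp (- real n) powr (2 * Re \<nu>)) \<longlonglongrightarrow> 0"
      by simp
    show "\<forall>\<^sub>F n in sequentially. norm (s n powr (2 * \<nu>)) \<le> exp (- real n) powr (2 * Re \<nu>)"
      by (simp add: s_def norm_powr_real_powr)
  qed
  moreover have "(\<lambda>n. s n powr \<nu> * macdonald_integral 0 \<nu> (2 * s n)) \<longlonglongrightarrow> Gamma \<nu>"
      "(\<lambda>n. s n powr (1 - \<nu>) * macdonald_integral 0 (1 - \<nu>) (2 * s n)) \<longlonglongrightarrow> Gamma (1 - \<nu>)"
    unfolding s_def using assms by (intro macdonald_integral_small_arg; simp)+
  moreover have "(\<lambda>n. bessel_series \<mu> ((s n)\<^sup>2)) \<longlonglongrightarrow> rGamma (\<mu> + 1)" for \<mu>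
    unfolding s_def by (rule bessel_series_small_arg)
  ultimately have "(\<lambda>n. 2 * s n * (macdonald_integral 0 \<nu> (2 * s n) * bessel_I (\<nu> - 1) (2 * s n)
        + macdonald_integral 0 (1 - \<nu>) (2 * s n) * bessel_I \<nu> (2 * s n)))
      \<longlonglongrightarrow> 2 * (Gamma \<nu> * rGamma (\<nu> - 1 + 1)) + 2 * (Gamma (1 - \<nu>) * rGamma (\<nu> + 1) * 0)"
    unfolding eq by (intro tendsto_intros)
  moreover have "Gamma \<nu> * rGamma \<nu> = 1"
  proof -
    have "\<nu> \<notin> \<int>\<^sub>\<le>\<^sub>0"
      using assms(1) by (auto elim!: nonpos_Ints_cases)
    then show ?thesis
      by (simp add: Gamma_def rGamma_eq_zero_iff)
  qed
  ultimately show "(\<lambda>n. 2 * of_real (exp (- real n)) * (macdonald_integral 0 \<nu> (2 * of_real (exp (- real n)))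
        * bessel_I (\<nu> - 1) (2 * of_real (exp (- real n)))
        + macdonald_integral 0 (1 - \<nu>) (2 * of_real (exp (- real n)))
        * bessel_I \<nu> (2 * of_real (exp (- real n))))) \<longlonglongrightarrow> 2"
    unfolding s_def by simp
qed

text \<open>In the first product the powers of the argument cancel, in the second they leave a
  square tending to 0. The limit \<open>2 * rGamma \<nu> * rGamma (1 - \<nu>)\<close> is evaluated
  by the reflection formula, for every order.\<close>

lemma wronskian_bessel_I:
  assumes "Re t > 0"
  shows "t * (bessel_I (\<nu> - 1) t * bessel_I (- \<nu>) t - bessel_I (1 - \<nu>) t * bessel_I \<nu> t)
    = 2 * sin (of_real pi * \<nu>) / of_real pi"
proof (rule eq_limit_along_exp[OF _ _ assms, where f = "\<lambda>t. t * (bessel_I (\<nu> - 1) t * bessel_I (- \<nu>) t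
      - bessel_I (1 - \<nu>) t * bessel_I \<nu> t)"])
  fix t :: complex assume t: "Re t > 0"
  then have t0: "t \<noteq> 0"
    by auto
  define P Q R S where "P = bessel_I (- \<nu>) t" and "Q = bessel_I (1 - \<nu>) t"
    and "R = bessel_I \<nu> t" and "S = bessel_I (\<nu> - 1) t"
  have dP: "(bessel_I (- \<nu>) has_field_derivative (Q - \<nu> / t * P)) (at t)"
    using bessel_I_deriv[OF t, of "- \<nu>"] by (simp add: P_def Q_def)
  have dQ: "(bessel_I (1 - \<nu>) has_field_derivative (P - (1 - \<nu>) / t * Q)) (at t)"
    using bessel_I_deriv_minus_one[OF t, of "1 - \<nu>"] by (simp add: P_def Q_def)
  have dR: "(bessel_I \<nu> has_field_derivative (S - \<nu> / t * R)) (at t)"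
    using bessel_I_deriv_minus_one[OF t, of \<nu>] by (simp add: R_def S_def)
  have dS: "(bessel_I (\<nu> - 1) has_field_derivative (R + (\<nu> - 1) / t * S)) (at t)"
    using bessel_I_deriv[OF t, of "\<nu> - 1"] by (simp add: R_def S_def)
  have "((\<lambda>t. t * (bessel_I (\<nu> - 1) t * bessel_I (- \<nu>) t - bessel_I (1 - \<nu>) t * bessel_I \<nu> t))
      has_field_derivative 1 * (S * P - Q * R) + ((R + (\<nu> - 1) / t * S) * P + (Q - \<nu> / t * P) * S
        - ((P - (1 - \<nu>) / t * Q) * R + (S - \<nu> / t * R) * Q)) * t) (at t)"
    unfolding P_def Q_def R_def S_def
    by (intro DERIV_mult DERIV_diff DERIV_ident dP[unfolded P_def Q_def] dQ[unfolded P_def Q_def]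
        dR[unfolded R_def S_def] dS[unfolded R_def S_def])
  also have "1 * (S * P - Q * R) + ((R + (\<nu> - 1) / t * S) * P + (Q - \<nu> / t * P) * S
        - ((P - (1 - \<nu>) / t * Q) * R + (S - \<nu> / t * R) * Q)) * t = 0"
    using t0 by (simp add: field_simps)
  finally show "((\<lambda>t. t * (bessel_I (\<nu> - 1) t * bessel_I (- \<nu>) t - bessel_I (1 - \<nu>) t * bessel_I \<nu> t))
      has_field_derivative 0) (at t)" .
next
  define s where "s n = (of_real (exp (- real n)) :: complex)" for n
  have s0: "s n \<noteq> 0" for n
    by (simp add: s_def)
  have eq: "2 * s n * (bessel_I (\<nu> - 1) (2 * s n) * bessel_I (- \<nu>) (2 * s n)
        - bessel_I (1 - \<nu>) (2 * s n) * bessel_I \<nu> (2 * s n))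
      = 2 * (bessel_series (\<nu> - 1) ((s n)\<^sup>2) * bessel_series (- \<nu>) ((s n)\<^sup>2))
      - 2 * ((s n)\<^sup>2 * (bessel_series (1 - \<nu>) ((s n)\<^sup>2) * bessel_series \<nu> ((s n)\<^sup>2)))" for n
    using s0[of n] by (simp add: bessel_I_eq powr_diff powr_minus field_simps power2_eq_square)
  have "(\<lambda>n. bessel_series \<mu> ((s n)\<^sup>2)) \<longlonglongrightarrow> rGamma (\<mu> + 1)" for \<mu>
    unfolding s_def by (rule bessel_series_small_arg)
  moreover have "s \<longlonglongrightarrow> of_real 0"
    unfolding s_def[abs_def] by (intro tendsto_of_real exp_minus_of_nat_tendsto_0)
  ultimately have "(\<lambda>n. 2 * s n * (bessel_I (\<nu> - 1) (2 * s n) * bessel_I (- \<nu>) (2 * s n)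
        - bessel_I (1 - \<nu>) (2 * s n) * bessel_I \<nu> (2 * s n)))
      \<longlonglongrightarrow> 2 * (rGamma (\<nu> - 1 + 1) * rGamma (- \<nu> + 1))
        - 2 * ((of_real 0)\<^sup>2 * (rGamma (1 - \<nu> + 1) * rGamma (\<nu> + 1)))"
    unfolding eq by (intro tendsto_intros)
  then show "(\<lambda>n. 2 * of_real (exp (- real n)) * (bessel_I (\<nu> - 1) (2 * of_real (exp (- real n)))
        * bessel_I (- \<nu>) (2 * of_real (exp (- real n)))
        - bessel_I (1 - \<nu>) (2 * of_real (exp (- real n)))
        * bessel_I \<nu> (2 * of_real (exp (- real n))))) \<longlonglongrightarrow> 2 * sin (of_real pi * \<nu>) / of_real pi"
    unfolding s_def using rGamma_reflection_complex[of \<nu>] by simp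
qed

lemma sin_times_macdonald_integral_strip:
  assumes "0 < Re \<nu>" "Re \<nu> < 1" "Re t > 0"
  shows "sin (of_real pi * \<nu>) * macdonald_integral 0 \<nu> t = of_real pi * (bessel_I (- \<nu>) t - bessel_I \<nu> t)"
proof -
  have t0: "t \<noteq> 0"
    using assms by auto
  define P Q where "P = macdonald_integral 0 \<nu> t" and "Q = macdonald_integral 0 (1 - \<nu>) t"
  define a b c d where "a = bessel_I (\<nu> - 1) t" and "b = bessel_I \<nu> t"
    and "c = bessel_I (- \<nu>) t" and "d = bessel_I (1 - \<nu>) t"
  \<comment> \<open>The second equation is the first one with \<open>1 - \<nu>\<close> in place of
    \<open>\<nu>\<close>. Weighting them by \<open>c\<close> and \<open>b\<close> and subtracting
    eliminates \<open>Q\<close>.\<close>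
  have "t * (P * a + Q * b) = 2" "t * (Q * c + P * d) = 2"
    using wronskian_macdonald_bessel[of \<nu> t] wronskian_macdonald_bessel[of "1 - \<nu>" t] assms
    by (simp_all add: P_def Q_def a_def b_def c_def d_def)
  then have "t * (P * a + Q * b) * c - t * (Q * c + P * d) * b = 2 * c - 2 * b"
    by (simp only:)
  then have "t * (a * c - d * b) * P = 2 * (c - b)"
    by (simp add: algebra_simps)
  moreover have "t * (a * c - d * b) = 2 * sin (of_real pi * \<nu>) / of_real pi"
    using wronskian_bessel_I[OF assms(3), of \<nu>] by (simp add: a_def b_def c_def d_def)
  ultimately have "2 * sin (of_real pi * \<nu>) / of_real pi * P = 2 * (c - b)"
    by (simp only:)
  then have "2 * (sin (of_real pi * \<nu>) * P) = 2 * (of_real pi * (c - b))"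
    by (simp add: field_simps)
  then have "sin (of_real pi * \<nu>) * P = of_real pi * (c - b)"
    by simp
  then show ?thesis
    by (simp only: P_def b_def c_def)
qed

section \<open>Continuation in the order from the strip to the whole plane\<close>

lemma macdonald_integral_holomorphic_order:
  "Re t > 0 \<Longrightarrow> (\<lambda>\<nu>. macdonald_integral n \<nu> t) holomorphic_on A"
  using macdonald_integral_deriv_order[of t n]
  by (meson holomorphic_onI field_differentiable_at_within field_differentiable_def)

lemma sin_times_macdonald_integral:
  assumes "Re t > 0"
  shows "sin (of_real pi * \<nu>) * macdonald_integral 0 \<nu> t = of_real pi * (bessel_I (- \<nu>) t - bessel_I \<nu> t)"
proof (rule analytic_continuation_open[where s = "{\<nu>. 0 < Re \<nu>} \<inter> {\<nu>. Re \<nu> < 1}" and s' = UNIV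
      and f = "\<lambda>\<nu>. sin (of_real pi * \<nu>) * macdonald_integral 0 \<nu> t"
      and g = "\<lambda>\<nu>. of_real pi * (bessel_I (- \<nu>) t - bessel_I \<nu> t)"])
  show "open ({\<nu>. 0 < Re \<nu>} \<inter> {\<nu>. Re \<nu> < 1})"
    by (intro open_Int open_halfspace_Re_gt open_halfspace_Re_lt)
  have "1 / 2 \<in> {\<nu>. 0 < Re \<nu>} \<inter> {\<nu>. Re \<nu> < 1}"
    by simp
  then show "{\<nu>. 0 < Re \<nu>} \<inter> {\<nu>. Re \<nu> < 1} \<noteq> {}"
    by blast
  have I: "(\<lambda>\<nu>. bessel_I \<nu> t) holomorphic_on UNIV"
    using assms by (intro bessel_I_holomorphic_order) auto
  then have "(\<lambda>\<nu>. bessel_I (- \<nu>) t) holomorphic_on UNIV"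
    using holomorphic_on_compose_gen[OF holomorphic_on_minus[OF holomorphic_on_ident]]
    by (force simp: o_def)
  with I show "(\<lambda>\<nu>. of_real pi * (bessel_I (- \<nu>) t - bessel_I \<nu> t)) holomorphic_on UNIV"
    by (intro holomorphic_intros)
  show "(\<lambda>\<nu>. sin (of_real pi * \<nu>) * macdonald_integral 0 \<nu> t) holomorphic_on UNIV"
    by (intro holomorphic_intros macdonald_integral_holomorphic_order assms)
qed (use assms sin_times_macdonald_integral_strip in auto)

subsection \<open>Derivatives with respect to the order\<close>

text \<open>At non-integer orders the sine can be divided out. At an integer the quotient equals
  half the integral on a punctured neighbourhood, and the integral is continuous in the order, so
  the limit exists and has the same value.\<close>

lemma macdonald_K_eq_integral:
  assumes "Re t > 0"
  shows "macdonald_K \<nu> t = macdonald_integral 0 \<nu> t / 2"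
proof -
  have quot: "macdonald_quot \<mu> t = macdonald_integral 0 \<mu> t / 2" if "\<mu> \<notin> \<int>" for \<mu>
  proof -
    have "sin (of_real pi * \<mu>) \<noteq> 0"
      using that by (auto simp: sin_eq_0 mult.commute)
    then have "macdonald_integral 0 \<mu> t
        = of_real pi * (bessel_I (- \<mu>) t - bessel_I \<mu> t) / sin (of_real pi * \<mu>)"
      using sin_times_macdonald_integral[OF assms, of \<mu>]
      by (metis nonzero_mult_div_cancel_left)
    then show ?thesis
      by (simp add: macdonald_quot_def)
  qed
  show ?thesis
  proof (cases "\<nu> \<in> \<int>")
    case True
    \<comment> \<open>Every set of integers is closed, so removing the integers other than
      \<open>\<nu>\<close> leaves an open neighbourhood of \<open>\<nu>\<close>.\<close>
    have "eventually (\<lambda>\<mu>. \<mu> \<in> - (\<int> - {\<nu>})) (nhds \<nu>)"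
      by (intro eventually_nhds_in_open open_Compl closed_subset_Ints) auto
    then have "eventually (\<lambda>\<mu>. \<mu> \<notin> \<int>) (at \<nu>)"
      unfolding eventually_at_filter by eventually_elim auto
    then have ev: "eventually (\<lambda>\<mu>. macdonald_integral 0 \<mu> t / 2 = macdonald_quot \<mu> t) (at \<nu>)"
      by eventually_elim (simp add: quot)
    have "((\<lambda>\<mu>. macdonald_integral 0 \<mu> t / 2) \<longlongrightarrow> macdonald_integral 0 \<nu> t / 2) (at \<nu>)"
      using DERIV_isCont[OF macdonald_integral_deriv_order[OF assms, of 0 \<nu>]]
      by (intro tendsto_intros) (simp_all add: isCont_def)
    from Lim_transform_eventually[OF this ev]
    have "((\<lambda>\<mu>. macdonald_quot \<mu> t) \<longlongrightarrow> macdonald_integral 0 \<nu> t / 2) (at \<nu>)" .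
    then show ?thesis
      using True by (simp add: macdonald_K_def tendsto_Lim)
  qed (simp add: macdonald_K_def quot)
qed

text \<open>An equality of functions of the order, so that \<open>deriv\<close> can be applied again
  in the induction.\<close>

lemma higher_deriv_macdonald_K:
  assumes "Re t > 0"
  shows "(deriv ^^ n) (\<lambda>\<mu>. macdonald_K \<mu> t) = (\<lambda>\<nu>. macdonald_integral n \<nu> t / 2)"
proof (induction n)
  case 0
  show ?case
    by (simp add: macdonald_K_eq_integral assms)
next
  case (Suc n)
  have "((\<lambda>\<nu>. macdonald_integral n \<nu> t / 2) has_field_derivative macdonald_integral (Suc n) \<nu> t / 2) (at \<nu>)" for \<nu>
    by (intro DERIV_cdivide macdonald_integral_deriv_order assms)
  then have "deriv (\<lambda>\<nu>. macdonald_integral n \<nu> t / 2) = (\<lambda>\<nu>. macdonald_integral (Suc n) \<nu> t / 2)"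
    by (intro ext DERIV_imp_deriv)
  then show ?case
    by (simp add: Suc.IH)
qed

text \<open>Both \<open>deriv\<close> and the Lebesgue integral are total and take default values.
  The first two conjuncts therefore state that all derivatives up to the \<open>n\<close>-th exist
  and that the integral converges absolutely.\<close>

theorem mainTheorem4:
  fixes n :: nat and \<nu> t :: complex
  assumes "Re t > 0"
  shows "(\<forall>m<n. (deriv ^^ m) (\<lambda>\<mu>. macdonald_K \<mu> t) field_differentiable at \<nu>) \<and>
    integrable lborel
      (\<lambda>x::real. of_real x ^ n * exp (\<nu> * of_real x - t * of_real (cosh x)) :: complex) \<and>
    (deriv ^^ n) (\<lambda>\<mu>. macdonald_K \<mu> t) \<nu> =
      1 / 2 * (LINT x|lborel. of_real x ^ n * exp (\<nu> * of_real x - t * of_real (cosh x)))"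
proof (intro conjI allI impI)
  have integrand: "(\<lambda>x. of_real x ^ n * exp (\<nu> * of_real x - t * of_real (cosh x)))
      = macdonald_integrand n 0 \<nu> t"
    by (simp add: macdonald_integrand_def fun_eq_iff)
  show "integrable lborel (\<lambda>x::real. of_real x ^ n * exp (\<nu> * of_real x - t * of_real (cosh x)) :: complex)"
    unfolding integrand by (rule integrable_macdonald_integrand[OF assms])
  show "(deriv ^^ n) (\<lambda>\<mu>. macdonald_K \<mu> t) \<nu> =
      1 / 2 * (LINT x|lborel. of_real x ^ n * exp (\<nu> * of_real x - t * of_real (cosh x)))"
    unfolding higher_deriv_macdonald_K[OF assms] macdonald_integral_def integrand by simp
  show "(deriv ^^ m) (\<lambda>\<mu>. macdonald_K \<mu> t) field_differentiable at \<nu>" for m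
    unfolding higher_deriv_macdonald_K[OF assms]
    using DERIV_cdivide[OF macdonald_integral_deriv_order[OF assms, of m \<nu>], of 2]
    by (auto simp: field_differentiable_def)
qed

end
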